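(* Let $j\in\{0,\tfrac12,1,\dots\}$, $m\in\{-j,\dots,j\}$, and let $\tilde P_j^m$ be the $h$-symplecton. In terms of the covariant $h$-oscillators $a_h,\bar a_h$ it can be written both as $$\tilde P_j^m=\frac{1}{2^{j-m}}\left[\frac{(2j)!\,(j-m)!}{(j+m)!}\right]^{1/2}\sum_{s=0}^{j-m}\frac{1}{s!\,(j-m-s)!}\;\bar a_h(\bar a_h+ha_h)\cdots\{\bar a_h+(j-m-s-1)ha_h\}\;a_h^{j+m}$$ $$\qquad\times\{\bar a_h-(2m+s)ha_h\}\{\bar a_h-(2m+s-1)ha_h\}\cdots\{\bar a_h-(2m+1)ha_h\}$$ and as $$\tilde P_j^m=\frac{1}{2^{j+m}}\left[\frac{(2j)!\,(j+m)!}{(j-m)!}\right]^{1/2}\sum_{s=0}^{j+m}\frac{1}{s!\,(j+m-s)!}\;a_h^s(\bar a_h-hsa_h)\{\bar a_h+h(1-s)a_h\}\cdots\{\bar a_h+h(j-m-1-s)a_h\}\;a_h^{j+m-s}.$$ (The products displayed have, respectively, $j-m-s$, $s$ and $j-m$ factors containing $\bar a_h$; empty products equal $1$.)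
   Context: Let $a,\bar a$ be boson operators with $[\bar a,a]=1$ (generators of the Weyl algebra), $h$ a formal parameter, $J_+=-\tfrac12a^2$, and $\sigma=-\ln(1-2hJ_+)=-\ln(1+ha^2)$, understood as a formal power series in $h$. The $sl(2)$ symplecton is $$P_j^m(a,\bar a)=\frac{1}{2^{j-m}}\left[\frac{(2j)!\,(j-m)!}{(j+m)!}\right]^{1/2}\sum_{s=0}^{j-m}\frac{\bar a^{\,j-m-s}a^{j+m}\bar a^{\,s}}{s!\,(j-m-s)!} =\frac{1}{2^{j+m}}\left[\frac{(2j)!\,(j+m)!}{(j-m)!}\right]^{1/2}\sum_{s=0}^{j+m}\frac{a^s\bar a^{\,j-m}a^{j+m-s}}{s!\,(j+m-s)!},$$ where the equality of the two forms is a known fact. The $h$-symplecton is $\tilde P_j^m=P_j^m(a,\bar a)\,e^{m\sigma}$. The covariant $h$-oscillators are the $j=\tfrac12$ members, $\bar a_h=\bar a\,e^{-\sigma/2}$ and $a_h=a\,e^{\sigma/2}$; they satisfy $[\bar a_h,a_h]=1-ha_h^2$. *)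

theory Defs
  imports "HOL-Computational_Algebra.Formal_Power_Series"
begin

text \<open>
  Throughout, \<open>a\<close> and \<open>ab\<close> (the letter \<open>a\<close> with a bar) are elements of an arbitrary, in general
  noncommutative, unital real algebra \<open>'a\<close> with \<open>ab * a - a * ab = 1\<close>; the real or complex Weyl
  algebra is the universal example.  Expressions involving the formal parameter \<open>h\<close> live
  in \<open>'a fps\<close>, in which \<open>h = fps_X\<close> is central and \<open>'a\<close> is embedded by \<^const>\<open>fps_const\<close>.
\<close>

abbreviation hpar :: "'a::real_algebra_1 fps" where
  "hpar \<equiv> fps_X"

abbreviation scal :: "real \<Rightarrow> 'a::real_algebra_1 fps" where
  "scal c \<equiv> fps_const (of_real c)"

text \<open>
  The real series \<open>F\<close> evaluated at \<open>f\<close>.  This is meaningful only if \<open>f\<close> has constant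
  coefficient 0, which is the case for all uses below.
\<close>
definition fps_subst :: "real fps \<Rightarrow> 'a::real_algebra_1 fps \<Rightarrow> 'a fps" where
  "fps_subst F f = Abs_fps (\<lambda>n. of_real (fps_nth F n)) oo f"

definition exp_series :: "'a::real_algebra_1 fps \<Rightarrow> 'a fps" where
  "exp_series f = fps_subst (fps_exp 1) f"

text \<open>\<open>ln1p_series f\<close> is \<open>ln (1 + f)\<close>, as \<open>fps_ln 1\<close> is the expansion of \<open>ln (1 + x)\<close>.\<close>
definition ln1p_series :: "'a::real_algebra_1 fps \<Rightarrow> 'a fps" where
  "ln1p_series f = fps_subst (fps_ln 1) f"

definition J_plus :: "'a::real_algebra_1 \<Rightarrow> 'a" where
  "J_plus a = - ((1/2) *\<^sub>R a ^ 2)"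

definition sigma :: "'a::real_algebra_1 \<Rightarrow> 'a fps" where
  "sigma a = - ln1p_series (- (2 * hpar * fps_const (J_plus a)))"

definition exp_sigma :: "real \<Rightarrow> 'a::real_algebra_1 \<Rightarrow> 'a fps" where
  "exp_sigma c a = exp_series (scal c * sigma a)"

text \<open>
  Spins and weights are real numbers; \<open>nt x\<close> is the natural number equal to \<open>x\<close>, and is
  applied only to \<open>2 * j\<close>, \<open>j + m\<close> and \<open>j - m\<close>, which are natural numbers when \<open>j\<close> is a spin
  and \<open>m\<close> is one of its weights.
\<close>
definition nt :: "real \<Rightarrow> nat" where
  "nt x = nat \<lfloor>x\<rfloor>"

definition spins :: "real set" where
  "spins = {real n / 2 | n. True}"

definition weights :: "real \<Rightarrow> real set" where
  "weights j = {- j + real k | k. - j + real k \<le> j}"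

definition symplecton :: "'a::real_algebra_1 \<Rightarrow> 'a \<Rightarrow> real \<Rightarrow> real \<Rightarrow> 'a" where
  "symplecton a ab j m =
     (1 / 2 ^ nt (j - m) * sqrt (fact (nt (2 * j)) * fact (nt (j - m)) / fact (nt (j + m)))) *\<^sub>R
     (\<Sum>s = 0..nt (j - m).
        (1 / (fact s * fact (nt (j - m) - s))) *\<^sub>R
        (ab ^ (nt (j - m) - s) * a ^ nt (j + m) * ab ^ s))"

definition h_symplecton :: "'a::real_algebra_1 \<Rightarrow> 'a \<Rightarrow> real \<Rightarrow> real \<Rightarrow> 'a fps" where
  "h_symplecton a ab j m = fps_const (symplecton a ab j m) * exp_sigma m a"

definition a_h :: "'a::real_algebra_1 \<Rightarrow> 'a fps" where
  "a_h a = fps_const a * exp_sigma (1/2) a"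

definition ab_h :: "'a::real_algebra_1 \<Rightarrow> 'a \<Rightarrow> 'a fps" where
  "ab_h a ab = fps_const ab * exp_sigma (- 1/2) a"

text \<open>
  The factor \<open>ab_h + c h a_h\<close>.  Products of such factors do not commute a priori, so they are
  written as products of lists, to be read from left to right.
\<close>
definition fac :: "'a::real_algebra_1 \<Rightarrow> 'a \<Rightarrow> real \<Rightarrow> 'a fps" where
  "fac a ab c = ab_h a ab + scal c * hpar * a_h a"

end

theory Submission
  imports Defs
begin

text \<open>
  Write \<open>u = 1 + h a\<^sup>2\<close>, so that \<open>exp_sigma c a = u powr (- c)\<close>.  The commutation relation gives
  \<open>[ab, u powr p] = 2 p h a u powr (p - 1)\<close>, hence every factor of the covariant oscillators is a
  conjugated \<open>ab\<close>: \<open>ab_h + c h a_h = u powr (- c/2) * ab * u powr ((c + 1)/2)\<close>.  Products of factors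
  whose parameters increase by 1 therefore telescope, and each summand on the right-hand sides
  becomes the corresponding summand of one of the two forms of the symplecton times \<open>u powr (- m)\<close>.

  The two forms of the symplecton agree because the maps \<open>x \<mapsto> a x + x a\<close> and \<open>x \<mapsto> ab x + x ab\<close>
  commute: up to scalars, both forms arise from 1 by applying the first map \<open>j + m\<close> times and
  the second one \<open>j - m\<close> times.
\<close>

section \<open>Real power series evaluated at \<open>h b\<close>\<close>

text \<open>The series \<open>F\<close> at \<open>h b\<close>. Its coefficients are real multiples
  of powers of the single element \<open>b\<close>, so evaluation is multiplicative, and identities
  between commutative real series carry over to \<open>'a fps\<close>.\<close>

definition fps_eval :: "'a::real_algebra_1 \<Rightarrow> real fps \<Rightarrow> 'a fps" where
  "fps_eval b F = Abs_fps (\<lambda>n. fps_nth F n *\<^sub>R b ^ n)"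

lemma fps_eval_nth [simp]: "fps_nth (fps_eval b F) n = fps_nth F n *\<^sub>R b ^ n"
  by (simp add: fps_eval_def)

lemma fps_eval_1 [simp]: "fps_eval b 1 = 1"
  by (rule fps_ext) simp

lemma fps_eval_uminus: "fps_eval b (- F) = - fps_eval b F"
  by (rule fps_ext) simp

lemma fps_eval_const_mult: "fps_eval b (fps_const c * F) = scal c * fps_eval b F"
  by (rule fps_ext) (simp add: scaleR_conv_of_real mult.assoc)

lemma fps_eval_mult: "fps_eval b (F * G) = fps_eval b F * fps_eval b G"
  by (rule fps_ext)
    (simp add: fps_mult_nth scaleR_sum_left mult_ac flip: power_add)

lemma fps_eval_power: "fps_eval b (F ^ n) = fps_eval b F ^ n"
  by (induction n) (simp_all add: fps_eval_mult)

text \<open>Powers of \<open>fps_eval b G\<close> are evaluations of powers of \<open>G\<close>.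
  Hence exp and ln of such elements can be computed by composing real series.\<close>

lemma fps_subst_fps_eval: "fps_subst F (fps_eval b G) = fps_eval b (F oo G)"
  by (rule fps_ext)
    (simp add: fps_subst_def fps_compose_nth scaleR_sum_left mult.commute flip: fps_eval_power scaleR_conv_of_real)

lemma fps_eval_commute:
  assumes "x * b = b * x"
  shows "fps_const x * fps_eval b F = fps_eval b F * fps_const x"
proof -
  have "x * b ^ n = b ^ n * x" for n
    using power_commuting_commutes[of b x n] assms by simp
  then show ?thesis
    by (intro fps_ext) simp
qed

lemma commutator_power:
  fixes a ab :: "'a::ring_1"
  assumes "ab * a - a * ab = 1"
  shows "ab * a ^ n = a ^ n * ab + of_nat n * a ^ (n - 1)"
proof (induction n)
  case 0
  then show ?case by simp
next
  case (Suc n)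
  have ab: "ab * a = a * ab + 1"
    using assms by (simp add: algebra_simps)
  have "ab * a ^ Suc n = (ab * a ^ n) * a"
    by (simp add: power_commutes mult.assoc)
  also have "\<dots> = a ^ n * (ab * a) + of_nat n * (a ^ (n - 1) * a)"
    by (simp add: Suc.IH distrib_right mult.assoc)
  \<comment> \<open>The case split is for \<open>n = 0\<close>: there \<open>n - 1\<close> truncates
    to 0, but the factor \<open>of_nat n\<close> vanishes.\<close>
  also have "of_nat n * (a ^ (n - 1) * a) = of_nat n * a ^ n"
    by (cases n) (simp_all add: power_commutes)
  also have "a ^ n * (ab * a) = a ^ Suc n * ab + a ^ n"
    by (simp add: ab distrib_left power_commutes flip: mult.assoc)
  finally show ?case
    by (simp add: distrib_right add.assoc add.commute)
qed

text \<open>Since \<open>[ab, a^(2n)] = 2 n a^(2n-1)\<close>, commutation with \<open>ab\<close>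
  differentiates \<open>F\<close> at \<open>h a^2\<close> and multiplies by \<open>2 h a\<close>,
  the derivative of \<open>h a^2\<close> in \<open>a\<close>.\<close>

lemma commutator_fps_eval_square:
  fixes a ab :: "'a::real_algebra_1"
  assumes "ab * a - a * ab = 1"
  shows "fps_const ab * fps_eval (a ^ 2) F =
    fps_eval (a ^ 2) F * fps_const ab + 2 * hpar * fps_const a * fps_eval (a ^ 2) (fps_deriv F)"
proof (rule fps_ext)
  fix n
  show "fps_nth (fps_const ab * fps_eval (a ^ 2) F) n =
    fps_nth (fps_eval (a ^ 2) F * fps_const ab +
      2 * hpar * fps_const a * fps_eval (a ^ 2) (fps_deriv F)) n"
  proof (cases n)
    case 0
    then show ?thesis
      by (simp add: mult.assoc)
  next
    case (Suc k)
    have "ab * (a ^ 2) ^ n = (a ^ 2) ^ n * ab + real (2 * n) *\<^sub>R a ^ (2 * n - 1)"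
      using commutator_power[OF assms, of "2 * n"]
      by (simp only: power_mult scaleR_conv_of_real of_real_of_nat_eq)
    moreover have "a ^ (2 * n - 1) = a * (a ^ 2) ^ k"
      by (simp add: Suc flip: power_mult)
    moreover have "2 * (a * (a ^ 2) ^ k) = 2 *\<^sub>R (a * (a ^ 2) ^ k)"
      by (simp add: scaleR_conv_of_real)
    ultimately show ?thesis
      by (simp add: Suc fps_numeral_fps_const algebra_simps)
  qed
qed

section \<open>The powers of \<open>u\<close>\<close>

text \<open>Both sides solve \<open>f' = p f / (1 + X)\<close> with constant coefficient 1, and the
  solution is unique.\<close>

lemma fps_exp_compose_fps_ln:
  fixes p :: "'a::field_char_0"
  shows "fps_exp 1 oo (fps_const p * fps_ln 1) = fps_binomial p"
proof (rule iffD1[OF fps_binomial_ODE_unique'], rule conjI)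
  show "fps_deriv (fps_exp 1 oo (fps_const p * fps_ln 1)) =
    fps_const p * (fps_exp 1 oo (fps_const p * fps_ln 1)) / (1 + fps_X)"
    by (simp add: fps_compose_deriv fps_ln_deriv fps_divide_unit mult_ac)
qed simp

lemma exp_sigma_eq_binomial: "exp_sigma c a = fps_eval (a ^ 2) (fps_binomial (- c))"
proof -
  have "- (2 * hpar * fps_const (J_plus a)) = fps_eval (a ^ 2) fps_X"
  proof (rule fps_ext)
    fix n
    show "fps_nth (- (2 * hpar * fps_const (J_plus a))) n = fps_nth (fps_eval (a ^ 2) fps_X) n"
      by (cases n) (auto simp: J_plus_def fps_numeral_fps_const mult.assoc simp flip: scaleR_2)
  qed
  then have "sigma a = fps_eval (a ^ 2) (- fps_ln 1)"
    by (simp add: sigma_def ln1p_series_def fps_subst_fps_eval fps_eval_uminus)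
  then have "scal c * sigma a = fps_eval (a ^ 2) (fps_const (- c) * fps_ln 1)"
    by (simp add: fps_eval_uminus fps_eval_const_mult flip: fps_const_neg)
  then show ?thesis
    by (simp only: exp_sigma_def exp_series_def fps_subst_fps_eval fps_exp_compose_fps_ln)
qed

lemma exp_sigma_0 [simp]: "exp_sigma 0 a = 1"
  by (simp add: exp_sigma_eq_binomial)

lemma exp_sigma_mult: "exp_sigma c a * exp_sigma d a = exp_sigma (c + d) a"
  by (simp add: exp_sigma_eq_binomial flip: fps_eval_mult fps_binomial_add_mult)

lemma exp_sigma_mult_left: "exp_sigma c a * (exp_sigma d a * f) = exp_sigma (c + d) a * f"
  by (simp add: exp_sigma_mult flip: mult.assoc)

lemma exp_sigma_commute: "exp_sigma c a * fps_const (a ^ n) = fps_const (a ^ n) * exp_sigma c a"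
  unfolding exp_sigma_eq_binomial
  by (rule fps_eval_commute[symmetric]) (simp flip: power_add add: add.commute)

lemma scal_commute: "f * scal c = scal c * f"
  by (rule fps_ext) (simp add: of_real_def)

lemma exp_sigma_mult_ab:
  fixes a ab :: "'a::real_algebra_1"
  assumes "ab * a - a * ab = 1"
  shows "exp_sigma c a * fps_const ab =
    fps_const ab * exp_sigma c a + scal (2 * c) * hpar * fps_const a * exp_sigma (c + 1) a"
proof -
  \<comment> \<open>Dividing by \<open>1 + X\<close> is multiplying by the binomial series of
    exponent -1, which lowers the exponent from \<open>- c\<close> to
    \<open>- (c + 1)\<close>.\<close>
  have "fps_deriv (fps_binomial (- c)) = fps_const (- c) * fps_binomial (- (c + 1))"
    using fps_binomial_add_mult[of "- c" "- 1"]
    by (simp add: fps_binomial_deriv fps_divide_unit fps_binomial_minus_one mult.assoc)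
  then have "fps_const ab * exp_sigma c a = exp_sigma c a * fps_const ab +
      2 * hpar * fps_const a * (scal (- c) * exp_sigma (c + 1) a)"
    unfolding exp_sigma_eq_binomial commutator_fps_eval_square[OF assms]
    by (simp only: fps_eval_const_mult)
  moreover have "2 * hpar * fps_const a * (scal (- c) * exp_sigma (c + 1) a) =
      - (scal (2 * c) * hpar * fps_const a * exp_sigma (c + 1) a)"
  proof -
    have "2 * hpar * fps_const a * scal (- c) = 2 * scal (- c) * hpar * fps_const a"
      by (simp only: mult.assoc scal_commute[of "hpar * _", unfolded mult.assoc])
    also have "2 * scal (- c) = - (scal (2 * c) :: 'a fps)"
      by (simp add: fps_numeral_fps_const)
    finally show ?thesis
      by (simp only: mult_minus_left flip: mult.assoc)
  qed
  ultimately show ?thesis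
    by simp
qed

section \<open>Products of factors\<close>

text \<open>Moving \<open>exp_sigma (c / 2) a\<close> to the right past \<open>ab\<close> creates
  exactly the term with coefficient \<open>c h\<close>. The right-hand exponential then brings the
  exponents to -1/2 for \<open>ab_h\<close> and 1/2 for \<open>a_h\<close>.\<close>

lemma fac_conv_conjugate:
  fixes a ab :: "'a::real_algebra_1"
  assumes "ab * a - a * ab = 1"
  shows "fac a ab c = exp_sigma (c / 2) a * fps_const ab * exp_sigma (- (c + 1) / 2) a"
proof -
  have "c / 2 + - (c + 1) / 2 = - 1 / 2" "c / 2 + 1 + - (c + 1) / 2 = 1 / 2"
    by (simp_all add: field_simps)
  then show ?thesis
    by (simp only: exp_sigma_mult_ab[OF assms] distrib_right mult.assoc exp_sigma_mult
        fac_def ab_h_def a_h_def) simp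
qed

text \<open>The right exponential of the factor with parameter \<open>c\<close> is inverse to the
  left exponential of the factor with parameter \<open>c + 1\<close>, so only the outermost two
  survive.\<close>

lemma prod_fac_increasing:
  fixes a ab :: "'a::real_algebra_1"
  assumes "ab * a - a * ab = 1"
  shows "(\<Prod>k\<leftarrow>[0..<n]. fac a ab (real k + c)) =
    exp_sigma (c / 2) a * fps_const (ab ^ n) * exp_sigma (- (real n + c) / 2) a"
proof (induction n)
  case 0
  then show ?case by (simp add: exp_sigma_mult)
next
  case (Suc n)
  have "- (real n + c) / 2 + (real n + c) / 2 = 0"
    by (simp add: field_simps)
  moreover have "- (real n + c + 1) / 2 = - (real (Suc n) + c) / 2"
    by simp
  ultimately have "(\<Prod>k\<leftarrow>[0..<Suc n]. fac a ab (real k + c)) =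
      exp_sigma (c / 2) a * (fps_const (ab ^ n) * fps_const ab) * exp_sigma (- (real (Suc n) + c) / 2) a"
    by (simp only: upt_Suc_append[OF zero_le] map_append prod_list.append Suc.IH list.map
        prod_list.Cons prod_list.Nil mult_1_right fac_conv_conjugate[OF assms, of "real n + c"] mult.assoc
        exp_sigma_mult_left exp_sigma_0 mult_1_left)
  then show ?case
    by (simp only: fps_const_mult power_Suc2)
qed

text \<open>Read from left to right the parameters again increase by 1, from
  \<open>- (c + s)\<close> to \<open>- (c + 1)\<close>. Here the induction adds the new factor on
  the left.\<close>

lemma prod_fac_reversed:
  fixes a ab :: "'a::real_algebra_1"
  assumes "ab * a - a * ab = 1"
  shows "(\<Prod>k\<leftarrow>rev [1..<Suc s]. fac a ab (- (c + real k))) =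
    exp_sigma (- (c + real s) / 2) a * fps_const (ab ^ s) * exp_sigma (c / 2) a"
proof (induction s)
  case 0
  then show ?case by (simp add: exp_sigma_mult)
next
  case (Suc s)
  have "- (- (c + real (Suc s)) + 1) / 2 + - (c + real s) / 2 = 0"
    by (simp add: field_simps)
  moreover have "rev [1..<Suc (Suc s)] = Suc s # rev [1..<Suc s]"
    by simp
  ultimately have "(\<Prod>k\<leftarrow>rev [1..<Suc (Suc s)]. fac a ab (- (c + real k))) =
      exp_sigma (- (c + real (Suc s)) / 2) a * (fps_const ab * (fps_const (ab ^ s) * exp_sigma (c / 2) a))"
    by (simp only: list.map prod_list.Cons Suc.IH fac_conv_conjugate[OF assms, of "- (c + real (Suc s))"] mult.assoc
        exp_sigma_mult_left exp_sigma_0 mult_1_left)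
  then show ?case
    by (simp flip: mult.assoc)
qed

lemma a_h_power: "a_h a ^ n = fps_const (a ^ n) * exp_sigma (real n / 2) a"
proof (induction n)
  case 0
  then show ?case by simp
next
  case (Suc n)
  have "a_h a ^ Suc n = fps_const a * (exp_sigma (1 / 2) a * fps_const (a ^ n)) * exp_sigma (real n / 2) a"
    unfolding power_Suc Suc.IH by (simp only: a_h_def mult.assoc)
  also have "\<dots> = fps_const a * fps_const (a ^ n) * exp_sigma (1 / 2 + real n / 2) a"
    by (simp only: exp_sigma_commute mult.assoc exp_sigma_mult)
  finally show ?case
    by (simp add: add_divide_distrib)
qed

section \<open>The two forms of the symplecton\<close>

definition anticommutator :: "'a::ring \<Rightarrow> 'a \<Rightarrow> 'a" where
  "anticommutator y x = y * x + x * y"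

lemma anticommutator_scaleR:
  fixes x :: "'a::real_algebra"
  shows "anticommutator y (c *\<^sub>R x) = c *\<^sub>R anticommutator y x"
  by (simp add: anticommutator_def scaleR_add_right)

lemma funpow_anticommutator_scaleR:
  fixes x :: "'a::real_algebra"
  shows "(anticommutator y ^^ n) (c *\<^sub>R x) = c *\<^sub>R (anticommutator y ^^ n) x"
  by (induction n) (simp_all add: anticommutator_scaleR)

lemma funpow_anticommutator_one:
  fixes y :: "'a::real_algebra_1"
  shows "(anticommutator y ^^ n) 1 = 2 ^ n *\<^sub>R y ^ n"
proof (induction n)
  case 0
  then show ?case by simp
next
  case (Suc n)
  have "anticommutator y (y ^ n) = 2 *\<^sub>R y ^ Suc n"
    by (simp add: anticommutator_def power_commutes scaleR_2)
  then show ?case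
    by (simp add: Suc.IH anticommutator_scaleR)
qed

text \<open>Left and right multiplications commute, so the commutator of the two maps sends
  \<open>x\<close> to \<open>[a, ab] x - x [a, ab]\<close>, which is 0 because
  \<open>[a, ab] = -1\<close> is central.\<close>

lemma anticommutator_commute:
  fixes a ab :: "'a::ring_1"
  assumes "ab * a - a * ab = 1"
  shows "anticommutator a (anticommutator ab x) = anticommutator ab (anticommutator a x)"
proof -
  have "ab * a = a * ab + 1"
    using assms by (simp add: algebra_simps)
  then have "ab * (a * x) = a * (ab * x) + x" "x * (ab * a) = x * (a * ab) + x"
    by (simp_all add: distrib_left distrib_right flip: mult.assoc)
  then show ?thesis
    by (simp add: anticommutator_def distrib_left distrib_right mult.assoc add_ac)
qed

lemma funpow_commute:
  assumes "\<And>x. f (g x) = g (f x)"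
  shows "(f ^^ m) ((g ^^ n) x) = (g ^^ n) ((f ^^ m) x)"
proof -
  have "f ((g ^^ n) x) = (g ^^ n) (f x)" for x
    by (induction n) (simp_all add: assms)
  then show ?thesis
    by (induction m) simp_all
qed

lemma funpow_anticommutator_swap:
  fixes a ab :: "'a::real_algebra_1"
  assumes "ab * a - a * ab = 1"
  shows "2 ^ p *\<^sub>R (anticommutator ab ^^ n) (a ^ p) = 2 ^ n *\<^sub>R (anticommutator a ^^ p) (ab ^ n)"
  using funpow_commute[of "anticommutator a" "anticommutator ab" p n 1, OF anticommutator_commute[OF assms]]
  by (simp add: funpow_anticommutator_one funpow_anticommutator_scaleR)

text \<open>This is the binomial theorem for the sum of left and right multiplication by
  \<open>y\<close>, which commute.\<close>

lemma funpow_anticommutator_eq_sum: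
  fixes x y :: "'a::real_algebra_1"
  shows "(anticommutator y ^^ n) x =
    fact n *\<^sub>R (\<Sum>s = 0..n. (1 / (fact s * fact (n - s))) *\<^sub>R (y ^ s * x * y ^ (n - s)))"
proof (induction n)
  case 0
  then show ?case by simp
next
  case (Suc n)
  define g where "g n s = (1 / (fact s * fact (n - s))) *\<^sub>R (y ^ s * x * y ^ (n - s))" for n s
  have left: "real (Suc s) *\<^sub>R g (Suc n) (Suc s) = y * g n s" for s
    by (simp add: g_def mult.assoc del: of_nat_Suc)
  have right: "real (Suc n - s) *\<^sub>R g (Suc n) s = g n s * y" if "s \<le> n" for s
    using that by (simp add: g_def Suc_diff_le mult.assoc power_commutes del: of_nat_Suc)
  \<comment> \<open>Split the weight \<open>Suc n\<close> as \<open>s + (Suc n - s)\<close>. The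
    first part cancels a factor of \<open>s!\<close> and frees a \<open>y\<close> on the left, the
    second does so on the right; the terms at \<open>s = 0\<close> and \<open>s = Suc n\<close>
    respectively drop out.\<close>
  have "real (Suc n) *\<^sub>R (\<Sum>s = 0..Suc n. g (Suc n) s) =
      (\<Sum>s = 0..Suc n. real s *\<^sub>R g (Suc n) s + real (Suc n - s) *\<^sub>R g (Suc n) s)"
    unfolding scaleR_sum_right
    by (rule sum.cong) (auto simp flip: scaleR_add_left)
  also have "\<dots> = (\<Sum>s = 0..Suc n. real s *\<^sub>R g (Suc n) s) +
      (\<Sum>s = 0..Suc n. real (Suc n - s) *\<^sub>R g (Suc n) s)"
    by (rule sum.distrib)
  also have "(\<Sum>s = 0..Suc n. real s *\<^sub>R g (Suc n) s) = y * (\<Sum>s = 0..n. g n s)"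
    by (simp only: sum.atLeast0_atMost_Suc_shift comp_def left sum_distrib_left) simp
  also have "(\<Sum>s = 0..Suc n. real (Suc n - s) *\<^sub>R g (Suc n) s) = (\<Sum>s = 0..n. g n s) * y"
    by (simp add: right sum_distrib_right del: of_nat_Suc of_nat_diff)
  finally have "real (Suc n) *\<^sub>R (\<Sum>s = 0..Suc n. g (Suc n) s) =
      anticommutator y (\<Sum>s = 0..n. g n s)"
    by (simp add: anticommutator_def)
  moreover have "(fact (Suc n) :: real) = fact n * real (Suc n)"
    by simp
  ultimately show ?case
    unfolding g_def[symmetric] funpow.simps comp_def Suc.IH[folded g_def]
    by (simp only: anticommutator_scaleR flip: scaleR_scaleR)
qed

text \<open>Both prefactors are \<open>sqrt (N! n! p!)\<close> divided by \<open>2 ^ n * p!\<close> and \<open>2 ^ p * n!\<close>, respectively.\<close>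
lemma symplecton_forms_eq:
  fixes a ab :: "'a::real_algebra_1"
  assumes "ab * a - a * ab = 1"
  shows "(1 / 2 ^ n * sqrt (fact N * fact n / fact p)) *\<^sub>R
      (\<Sum>s = 0..n. (1 / (fact s * fact (n - s))) *\<^sub>R (ab ^ (n - s) * a ^ p * ab ^ s)) =
    (1 / 2 ^ p * sqrt (fact N * fact p / fact n)) *\<^sub>R
      (\<Sum>s = 0..p. (1 / (fact s * fact (p - s))) *\<^sub>R (a ^ s * ab ^ n * a ^ (p - s)))"
  (is "?c *\<^sub>R ?X = ?d *\<^sub>R ?Y")
proof -
  \<comment> \<open>Reversing the order of summation matches the binomial expansion, which has
    \<open>y ^ s\<close> on the left.\<close>
  have X: "?X = (\<Sum>s = 0..n. (1 / (fact s * fact (n - s))) *\<^sub>R (ab ^ s * a ^ p * ab ^ (n - s)))"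
    by (subst sum.atLeastAtMost_rev) (simp add: mult.commute)
  have swap: "(2 ^ p * fact n :: real) *\<^sub>R ?X = (2 ^ n * fact p :: real) *\<^sub>R ?Y"
    using funpow_anticommutator_swap[OF assms, of p n]
    by (simp add: funpow_anticommutator_eq_sum X)
  have "sqrt (fact N * fact n / fact p) = sqrt (fact N * fact n * fact p) / fact p"
    "sqrt (fact N * fact p / fact n) = sqrt (fact N * fact n * fact p) / fact n"
    by (simp_all add: real_sqrt_mult real_sqrt_divide field_simps)
  then obtain r :: real where r: "?c = r * (2 ^ p * fact n)" "?d = r * (2 ^ n * fact p)"
    by (intro that[of "sqrt (fact N * fact n * fact p) / (2 ^ n * 2 ^ p * fact n * fact p)"])
      (simp_all add: field_simps)
  show ?thesis
    unfolding r using swap by (simp only: flip: scaleR_scaleR)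
qed

section \<open>The \<open>h\<close>-symplecton\<close>

text \<open>Used with \<open>e = exp_sigma m a\<close>, this reduces each of the two formulas to an
  identity between single summands.\<close>

lemma fps_const_scaleR_sum_mult:
  fixes f :: "'b \<Rightarrow> 'a::real_algebra_1"
  assumes "\<And>s. s \<in> S \<Longrightarrow> fps_const (f s) * e = g s"
  shows "fps_const (c *\<^sub>R (\<Sum>s\<in>S. d s *\<^sub>R f s)) * e = scal c * (\<Sum>s\<in>S. scal (d s) * g s)"
proof -
  have "fps_const (c *\<^sub>R (\<Sum>s\<in>S. d s *\<^sub>R f s)) = scal c * (\<Sum>s\<in>S. scal (d s) * fps_const (f s))"
    by (rule fps_ext) (simp add: fps_sum_nth scaleR_conv_of_real)
  then show ?thesis
    using assms by (simp only: mult.assoc sum_distrib_right cong: sum.cong)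
qed

lemma spin_weight_nat:
  assumes "j \<in> spins" "m \<in> weights j"
  obtains n p where "nt (j - m) = n" "nt (j + m) = p" "2 * m = real p - real n"
proof -
  from assms obtain N k where j: "j = real N / 2" and m: "m = - j + real k" and "m \<le> j"
    by (auto simp: spins_def weights_def)
  then have "k \<le> N"
    by (simp add: field_simps)
  then have "j - m = real (N - k)" "j + m = real k"
    using j m by (simp_all add: of_nat_diff)
  then show thesis
    by (intro that[of "N - k" k]) (simp_all add: nt_def)
qed

theorem proposition5p2:
  fixes a ab :: "'a::real_algebra_1" and j m :: real
  assumes "ab * a - a * ab = 1"
    and "j \<in> spins" and "m \<in> weights j"
  shows
    "h_symplecton a ab j m =
       scal (1 / 2 ^ nt (j - m) *
             sqrt (fact (nt (2 * j)) * fact (nt (j - m)) / fact (nt (j + m)))) *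
       (\<Sum>s = 0..nt (j - m).
          scal (1 / (fact s * fact (nt (j - m) - s))) *
          (\<Prod>k\<leftarrow>[0..<nt (j - m) - s]. fac a ab (real k)) *
          a_h a ^ nt (j + m) *
          (\<Prod>k\<leftarrow>rev [1..<Suc s]. fac a ab (- (2 * m + real k))))
     \<and>
     h_symplecton a ab j m =
       scal (1 / 2 ^ nt (j + m) *
             sqrt (fact (nt (2 * j)) * fact (nt (j + m)) / fact (nt (j - m)))) *
       (\<Sum>s = 0..nt (j + m).
          scal (1 / (fact s * fact (nt (j + m) - s))) *
          a_h a ^ s *
          (\<Prod>k\<leftarrow>[0..<nt (j - m)]. fac a ab (real k - real s)) *
          a_h a ^ (nt (j + m) - s))"
proof -
  obtain n p where n: "nt (j - m) = n" and p: "nt (j + m) = p" and m: "2 * m = real p - real n"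
    using spin_weight_nat assms(2,3) .
  have first: "fps_const (ab ^ (n - s) * a ^ p * ab ^ s) * exp_sigma m a =
      (\<Prod>k\<leftarrow>[0..<n - s]. fac a ab (real k)) * a_h a ^ p *
      (\<Prod>k\<leftarrow>rev [1..<Suc s]. fac a ab (- (2 * m + real k)))" if "s \<in> {0..n}" for s
  proof -
    \<comment> \<open>All exponentials standing between the powers of \<open>ab\<close> and
      \<open>a\<close> meet in front of \<open>ab ^ s\<close> and cancel, as
      \<open>2 m = p - n\<close>; only \<open>exp_sigma m a\<close> at the right end
      remains.\<close>
    have "- (real (n - s) + 0) / 2 + (real p / 2 + - (2 * m + real s) / 2) = 0"
      using that m by (simp add: field_simps)
    moreover have "(\<Prod>k\<leftarrow>[0..<n - s]. fac a ab (real k)) =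
        fps_const (ab ^ (n - s)) * exp_sigma (- (real (n - s) + 0) / 2) a"
      using prod_fac_increasing[OF assms(1), of 0 "n - s"]
      by (simp only: add_0_right div_0 exp_sigma_0 mult_1_left)
    moreover have "exp_sigma c a * (fps_const (a ^ p) * f) = fps_const (a ^ p) * (exp_sigma c a * f)"
      for c f
      by (simp add: exp_sigma_commute flip: mult.assoc)
    ultimately have "(\<Prod>k\<leftarrow>[0..<n - s]. fac a ab (real k)) * a_h a ^ p *
        (\<Prod>k\<leftarrow>rev [1..<Suc s]. fac a ab (- (2 * m + real k))) =
        fps_const (ab ^ (n - s)) * (fps_const (a ^ p) * (fps_const (ab ^ s) * exp_sigma (2 * m / 2) a))"
      by (simp only: prod_fac_reversed[OF assms(1)] a_h_power mult.assoc exp_sigma_mult_left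
          exp_sigma_0 mult_1_left)
    then show ?thesis
      by (simp flip: mult.assoc)
  qed
  have second: "fps_const (a ^ s * ab ^ n * a ^ (p - s)) * exp_sigma m a =
      a_h a ^ s * (\<Prod>k\<leftarrow>[0..<n]. fac a ab (real k - real s)) * a_h a ^ (p - s)" if "s \<in> {0..p}" for s
  proof -
    \<comment> \<open>The first equation cancels the exponential of \<open>a_h ^ s\<close> against
      the head of the product of factors. The second collects its tail and that of the last power
      into \<open>exp_sigma m a\<close>.\<close>
    have "real s / 2 + - real s / 2 = 0" "- (real n + - real s) / 2 + real (p - s) / 2 = m"
      using that m by (simp_all add: field_simps)
    moreover have "exp_sigma c a * (fps_const (a ^ (p - s)) * f) =
        fps_const (a ^ (p - s)) * (exp_sigma c a * f)" for c f
      by (simp add: exp_sigma_commute flip: mult.assoc)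
    ultimately have "a_h a ^ s * (\<Prod>k\<leftarrow>[0..<n]. fac a ab (real k + - real s)) * a_h a ^ (p - s) =
        fps_const (a ^ s) * (fps_const (ab ^ n) * (fps_const (a ^ (p - s)) * exp_sigma m a))"
      by (simp only: prod_fac_increasing[OF assms(1)] a_h_power mult.assoc exp_sigma_mult_left
          exp_sigma_mult exp_sigma_0 mult_1_left)
    then show ?thesis
      by (simp flip: mult.assoc)
  qed
  show ?thesis
    unfolding h_symplecton_def symplecton_def n p
  proof (rule conjI)
    show "fps_const ((1 / 2 ^ n * sqrt (fact (nt (2 * j)) * fact n / fact p)) *\<^sub>R
        (\<Sum>s = 0..n. (1 / (fact s * fact (n - s))) *\<^sub>R (ab ^ (n - s) * a ^ p * ab ^ s))) *
        exp_sigma m a =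
      scal (1 / 2 ^ n * sqrt (fact (nt (2 * j)) * fact n / fact p)) *
      (\<Sum>s = 0..n. scal (1 / (fact s * fact (n - s))) *
        (\<Prod>k\<leftarrow>[0..<n - s]. fac a ab (real k)) * a_h a ^ p *
        (\<Prod>k\<leftarrow>rev [1..<Suc s]. fac a ab (- (2 * m + real k))))"
      by (simp only: fps_const_scaleR_sum_mult[OF first]) (simp only: mult.assoc)
    show "fps_const ((1 / 2 ^ n * sqrt (fact (nt (2 * j)) * fact n / fact p)) *\<^sub>R
        (\<Sum>s = 0..n. (1 / (fact s * fact (n - s))) *\<^sub>R (ab ^ (n - s) * a ^ p * ab ^ s))) *
        exp_sigma m a =
      scal (1 / 2 ^ p * sqrt (fact (nt (2 * j)) * fact p / fact n)) *
      (\<Sum>s = 0..p. scal (1 / (fact s * fact (p - s))) * a_h a ^ s *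
        (\<Prod>k\<leftarrow>[0..<n]. fac a ab (real k - real s)) * a_h a ^ (p - s))"
      unfolding symplecton_forms_eq[OF assms(1)]
      by (simp only: fps_const_scaleR_sum_mult[OF second]) (simp only: mult.assoc)
  qed
qed

end
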